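(* Let $n>3$ be odd and $m<n$ a positive integer with $\gcd(m,n)=\gcd(m-1,n)=1$. Let $t$ be a positive integer. If $\langle H\cup I\rangle$ is a neutrosophic subloop of $\langle L_n(m)\cup I\rangle$ of order $2(t+1)$, then $t$ divides $n$.
   Context: For $n>3$ odd and $m<n$ a positive integer with $\gcd(m,n)=\gcd(m-1,n)=1$, the loop $L_n(m)$ is the set $\{e,1,2,\dots,n\}$ with operation: $e\cdot i=i\cdot e=i$ for all $i$; $i\cdot i=e$ for all $i$; and for $i,j\in\{1,\dots,n\}$, $i\neq j$, $i\cdot j$ is the element $s\in\{1,\dots,n\}$ with $s\equiv mj-(m-1)i \pmod n$. The neutrosophic loop $\langle L_n(m)\cup I\rangle$ is the set $\{e,1,\dots,n,eI,1I,\dots,nI\}$ of $2(n+1)$ distinct symbols, with the product of $L_n(m)$ on $\{e,1,\dots,n\}$ and $x\cdot(yI)=(xI)\cdot y=(xI)\cdot(yI)=(x\cdot y)I$ for $x,y\in L_n(m)$. A neutrosophic subloop $\langle H\cup I\rangle$ is a subset of the form $H\cup\{xI:x\in H\}$, where $H$ is a subloop of $L_n(m)$. The order is the number of elements. *)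

theory Defs
  imports "HOL-Algebra.Group" "HOL-Number_Theory.Cong"
begin

text \<open>
  The record type of HOL-Algebra's monoids supplies carrier, product and identity element;
  no associativity is assumed.
\<close>

locale loop =
  fixes L (structure)
  assumes m_closed: "x \<in> carrier L \<Longrightarrow> y \<in> carrier L \<Longrightarrow> x \<otimes> y \<in> carrier L"
    and one_closed: "\<one> \<in> carrier L"
    and l_one: "x \<in> carrier L \<Longrightarrow> \<one> \<otimes> x = x"
    and r_one: "x \<in> carrier L \<Longrightarrow> x \<otimes> \<one> = x"
    and r_div: "a \<in> carrier L \<Longrightarrow> b \<in> carrier L \<Longrightarrow> \<exists>!x. x \<in> carrier L \<and> a \<otimes> x = b"
    and l_div: "a \<in> carrier L \<Longrightarrow> b \<in> carrier L \<Longrightarrow> \<exists>!y. y \<in> carrier L \<and> y \<otimes> a = b"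

definition subloop :: "'a set \<Rightarrow> ('a, 'b) monoid_scheme \<Rightarrow> bool" where
  "subloop H L \<longleftrightarrow> H \<subseteq> carrier L \<and> loop (L\<lparr>carrier := H\<rparr>)"

text \<open>\<open>E\<close> is the identity $e$; \<open>Pt i\<close> is the element $i \in \{1, \dots, n\}$.\<close>

datatype elt = E | Pt nat

fun Ln_mult :: "nat \<Rightarrow> nat \<Rightarrow> elt \<Rightarrow> elt \<Rightarrow> elt" where
  "Ln_mult n m E y = y"
| "Ln_mult n m (Pt i) E = Pt i"
| "Ln_mult n m (Pt i) (Pt j) =
     (if i = j then E
      else Pt (THE s. s \<in> {1..n} \<and>
             [int s = int m * int j - (int m - 1) * int i] (mod int n)))"

definition Ln :: "nat \<Rightarrow> nat \<Rightarrow> elt monoid" where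
  "Ln n m = \<lparr>carrier = insert E (Pt ` {1..n}), monoid.mult = Ln_mult n m, one = E\<rparr>"

text \<open>\<open>Plain x\<close> is $x$ and \<open>Ind x\<close> is the formal symbol $xI$.\<close>

datatype 'a neutrosophic = Plain 'a | Ind 'a

fun neutrosophic_mult ::
  "('a, 'b) monoid_scheme \<Rightarrow> 'a neutrosophic \<Rightarrow> 'a neutrosophic \<Rightarrow> 'a neutrosophic" where
  "neutrosophic_mult L (Plain x) (Plain y) = Plain (x \<otimes>\<^bsub>L\<^esub> y)"
| "neutrosophic_mult L (Plain x) (Ind y) = Ind (x \<otimes>\<^bsub>L\<^esub> y)"
| "neutrosophic_mult L (Ind x) (Plain y) = Ind (x \<otimes>\<^bsub>L\<^esub> y)"
| "neutrosophic_mult L (Ind x) (Ind y) = Ind (x \<otimes>\<^bsub>L\<^esub> y)"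

text \<open>
  This is $\langle L \cup I \rangle$. It need not satisfy the locale \<open>loop\<close>: products with
  \<open>Ind\<close> elements are not cancellative.
\<close>

definition neutrosophic_loop :: "('a, 'b) monoid_scheme \<Rightarrow> 'a neutrosophic monoid" where
  "neutrosophic_loop L =
     \<lparr>carrier = Plain ` carrier L \<union> Ind ` carrier L,
      monoid.mult = neutrosophic_mult L, one = Plain \<one>\<^bsub>L\<^esub>\<rparr>"

text \<open>\<open>K\<close> is a neutrosophic subloop of \<open>neutrosophic_loop L\<close>, that is, $K = \langle H \cup I \rangle$.\<close>

definition neutrosophic_subloop ::
  "'a neutrosophic set \<Rightarrow> ('a, 'b) monoid_scheme \<Rightarrow> bool" where
  "neutrosophic_subloop K L \<longleftrightarrow>
     (\<exists>H. subloop H L \<and> K = carrier (neutrosophic_loop (L\<lparr>carrier := H\<rparr>)))"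

end

theory Submission
  imports Defs "HOL-Algebra.Elementary_Groups"
begin

text \<open>
  Discard the identity of \<open>H\<close>, leaving a set \<open>S\<close> of \<open>t\<close> residues modulo \<open>n\<close>, and choose a base
  point \<open>a \<in> S\<close>. The operation \<open>(x, y) \<mapsto> m y - (m - 1) x\<close> has coefficients summing to \<open>1\<close>, so it
  commutes with translations, and the translate \<open>T = S - a\<close> is again closed under it; moreover
  \<open>0 \<in> T\<close>. Taking \<open>x = 0\<close> or \<open>y = 0\<close> shows that \<open>T\<close> is closed under multiplication by \<open>m\<close> and by
  \<open>1 - m\<close>. Both are units modulo \<open>n\<close>, so these multiplications are injective on the finite set \<open>T\<close>
  and hence permute it. Any two elements of \<open>T\<close> can therefore be written as \<open>m y\<close> and
  \<open>(1 - m) x\<close> with \<open>x, y \<in> T\<close>, and their sum is the value of the operation at \<open>(x, y)\<close>: the set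
  \<open>T\<close> is closed under addition. Thus \<open>T\<close> is a subgroup of \<open>\<int>/n\<close> (lemma \<open>affine_closed_imp_subgroup\<close>), and
  Lagrange's theorem shows that \<open>t = |T|\<close> divides \<open>n\<close>. In other words, every subloop of \<open>L\<^sub>n(m)\<close> is \<open>{e}\<close> or
  \<open>{e}\<close> together with a coset of a subgroup.
\<close>

section \<open>Affinely closed sets of residues\<close>

text \<open>Residues are represented by the integers \<open>0, \<dots>, n - 1\<close>, as in \<open>integer_mod_group\<close>.\<close>

lemma mult_unit_permutes:
  fixes c N :: int
  assumes sub: "T \<subseteq> {0..<N}" and "coprime c N"
    and closed: "\<And>x. x \<in> T \<Longrightarrow> c * x mod N \<in> T"
  shows "(\<lambda>x. c * x mod N) ` T = T"
proof (rule endo_inj_surj)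
  show "finite T" using sub finite_subset by blast
  show "(\<lambda>x. c * x mod N) ` T \<subseteq> T" using closed by blast
  show "inj_on (\<lambda>x. c * x mod N) T"
  proof (rule inj_onI)
    fix x y assume "x \<in> T" "y \<in> T" and "c * x mod N = c * y mod N"
    then have "[x = y] (mod N)"
      using \<open>coprime c N\<close> by (simp add: cong_mult_lcancel flip: cong_def)
    with \<open>x \<in> T\<close> \<open>y \<in> T\<close> sub show "x = y"
      by (auto simp: cong_def subset_iff)
  qed
qed

text \<open>
  Inverses come for free from finiteness: translation by an element \<open>x\<close> permutes \<open>T\<close>, so it takes
  the value \<open>0\<close> somewhere on \<open>T\<close>.
\<close>

lemma add_closed_imp_subgroup:
  fixes T :: "int set"
  assumes sub: "T \<subseteq> {0..<int n}" and "0 \<in> T"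
    and closed: "\<And>x y. x \<in> T \<Longrightarrow> y \<in> T \<Longrightarrow> (x + y) mod int n \<in> T"
  shows "subgroup T (integer_mod_group n)"
proof -
  interpret group "integer_mod_group n" by simp
  have "n > 0" using sub \<open>0 \<in> T\<close> by auto
  then have sub': "T \<subseteq> carrier (integer_mod_group n)"
    using sub by (simp add: carrier_integer_mod_group)
  show ?thesis
  proof (rule subgroupI)
    fix x assume "x \<in> T"
    have "(\<lambda>y. (x + y) mod int n) ` T = T"
    proof (rule endo_inj_surj)
      show "finite T" using sub finite_subset by blast
      show "(\<lambda>y. (x + y) mod int n) ` T \<subseteq> T" using closed \<open>x \<in> T\<close> by blast
      show "inj_on (\<lambda>y. (x + y) mod int n) T"
      proof (rule inj_onI)
        fix y z assume "y \<in> T" "z \<in> T" and "(x + y) mod int n = (x + z) mod int n"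
        then have "[y = z] (mod int n)"
          by (simp add: cong_add_lcancel flip: cong_def)
        with \<open>y \<in> T\<close> \<open>z \<in> T\<close> sub show "y = z"
          by (auto simp: cong_def subset_iff)
      qed
    qed
    with \<open>0 \<in> T\<close> have "0 \<in> (\<lambda>y. (x + y) mod int n) ` T" by (simp only:)
    then obtain y where "y \<in> T" and "0 = (x + y) mod int n" by (rule imageE)
    then have "inv\<^bsub>integer_mod_group n\<^esub> x = y"
      using \<open>x \<in> T\<close> sub' by (intro inv_equality) (auto simp: add.commute)
    with \<open>y \<in> T\<close> show "inv\<^bsub>integer_mod_group n\<^esub> x \<in> T" by simp
  qed (use sub' \<open>0 \<in> T\<close> closed in auto)
qed

text \<open>
  Addition is recovered from the affine operation by undoing its two coefficients, each of which
  permutes \<open>T\<close> because \<open>0 \<in> T\<close>.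
\<close>

lemma affine_closed_imp_subgroup:
  fixes T :: "int set" and c :: int
  assumes sub: "T \<subseteq> {0..<int n}" and "0 \<in> T"
    and "coprime c (int n)" and "coprime (1 - c) (int n)"
    and closed: "\<And>x y. x \<in> T \<Longrightarrow> y \<in> T \<Longrightarrow> (c * y + (1 - c) * x) mod int n \<in> T"
  shows "subgroup T (integer_mod_group n)"
proof (rule add_closed_imp_subgroup[OF sub \<open>0 \<in> T\<close>])
  fix u v assume "u \<in> T" "v \<in> T"
  have "(\<lambda>y. c * y mod int n) ` T = T"
    using closed[OF \<open>0 \<in> T\<close>] by (intro mult_unit_permutes assms) simp
  with \<open>u \<in> T\<close> obtain y where y: "y \<in> T" "u = c * y mod int n" by blast
  have "(\<lambda>x. (1 - c) * x mod int n) ` T = T"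
    using closed[OF _ \<open>0 \<in> T\<close>] by (intro mult_unit_permutes assms) simp
  with \<open>v \<in> T\<close> obtain x where x: "x \<in> T" "v = (1 - c) * x mod int n" by blast
  have "(u + v) mod int n = (c * y + (1 - c) * x) mod int n"
    unfolding x(2) y(2) by (rule mod_add_eq)
  with closed[OF x(1) y(1)] show "(u + v) mod int n \<in> T" by (simp only:)
qed

lemma representative_unique:
  assumes "i \<in> {1..n}" "j \<in> {1..n}" and "[int i = int j] (mod int n)"
  shows "i = j"
proof (rule ccontr)
  assume "i \<noteq> j"
  with assms(3) have "int n \<le> \<bar>int i - int j\<bar>"
    using dvd_imp_le_int[of "int i - int j" "int n"] by (simp add: cong_iff_dvd_diff)
  moreover have "1 \<le> i" "i \<le> n" "1 \<le> j" "j \<le> n" using assms(1,2) by simp_all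
  ultimately show False by linarith
qed

text \<open>
  The base-point-free version: \<open>S\<close> is a set of representatives modulo \<open>n\<close>, and subtracting one
  of its elements reduces to the previous lemma.
\<close>

lemma card_affine_closed_dvd:
  fixes S :: "nat set" and c :: int
  assumes sub: "S \<subseteq> {1..n}" and "S \<noteq> {}"
    and cop: "coprime c (int n)" "coprime (1 - c) (int n)"
    and closed: "\<And>i j. i \<in> S \<Longrightarrow> j \<in> S \<Longrightarrow>
                   \<exists>s\<in>S. [int s = c * int j - (c - 1) * int i] (mod int n)"
  shows "card S dvd n"
proof -
  obtain a where "a \<in> S" using \<open>S \<noteq> {}\<close> by blast
  then have "n > 0" using sub by auto
  define f where "f s = (int s - int a) mod int n" for s
  have inj: "inj_on f S"
  proof (rule inj_onI)
    fix i j assume ij: "i \<in> S" "j \<in> S" and "f i = f j"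
    then have "int n dvd (int i - int a) - (int j - int a)"
      unfolding f_def mod_eq_dvd_iff by (simp only:)
    then have "[int i = int j] (mod int n)"
      by (simp add: cong_iff_dvd_diff)
    with ij sub show "i = j" by (blast intro: representative_unique)
  qed
  have "subgroup (f ` S) (integer_mod_group n)"
  proof (rule affine_closed_imp_subgroup[OF _ _ cop])
    show "f ` S \<subseteq> {0..<int n}" using \<open>n > 0\<close> by (auto simp: f_def)
    show "0 \<in> f ` S" using \<open>a \<in> S\<close> by (force simp: f_def)
  next
    fix x y assume "x \<in> f ` S" "y \<in> f ` S"
    then obtain i j where ij: "i \<in> S" "x = f i" "j \<in> S" "y = f j" by blast
    then obtain s where s: "s \<in> S" "[int s = c * int j - (c - 1) * int i] (mod int n)"
      using closed by blast
    have "[c * y + (1 - c) * x = c * (int j - int a) + (1 - c) * (int i - int a)] (mod int n)"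
      unfolding ij f_def by (intro cong_add cong_mult cong_refl) (auto simp: cong_def)
    also have "c * (int j - int a) + (1 - c) * (int i - int a)
                 = (c * int j - (c - 1) * int i) - int a"
      by (simp add: algebra_simps)
    also have "[\<dots> = int s - int a] (mod int n)"
      using s(2) by (intro cong_diff cong_refl) (rule cong_sym)
    finally show "(c * y + (1 - c) * x) mod int n \<in> f ` S"
      using s(1) by (auto simp: cong_def f_def)
  qed
  then have "card (f ` S) dvd order (integer_mod_group n)"
    using group.lagrange[OF group_integer_mod_group] by (metis dvd_triv_right)
  then show ?thesis
    using \<open>n > 0\<close> by (simp add: card_image[OF inj] order_def carrier_integer_mod_group)
qed

section \<open>Subloops of \<open>L\<^sub>n(m)\<close>\<close>

lemma ex1_representative:
  assumes "n > 0"
  shows "\<exists>!s. s \<in> {1..n} \<and> [int s = k] (mod int n)"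
proof (rule ex_ex1I)
  define r where "r = nat (k mod int n)"
  have r: "int r = k mod int n" using assms by (simp add: r_def)
  \<comment> \<open>The representatives start at \<open>1\<close>, so the residue \<open>0\<close> is represented by \<open>n\<close>.\<close>
  have "(if r = 0 then n else r) \<in> {1..n}"
  proof -
    have "int r < int n" using r assms by simp
    then show ?thesis using assms by auto
  qed
  moreover have "[int (if r = 0 then n else r) = k] (mod int n)"
    using r by (auto simp: cong_def)
  ultimately show "\<exists>s. s \<in> {1..n} \<and> [int s = k] (mod int n)" by blast
next
  fix s s' assume *: "s \<in> {1..n} \<and> [int s = k] (mod int n)" "s' \<in> {1..n} \<and> [int s' = k] (mod int n)"
  then have "[int s = int s'] (mod int n)" by (metis cong_sym cong_trans)
  with * show "s = s'" by (blast intro: representative_unique)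
qed

lemma Ln_mult_Pt_obtain:
  assumes "n > 0" "i \<noteq> j"
  obtains s where "Ln_mult n m (Pt i) (Pt j) = Pt s"
    and "[int s = int m * int j - (int m - 1) * int i] (mod int n)"
  using theI'[OF ex1_representative[OF \<open>n > 0\<close>, of "int m * int j - (int m - 1) * int i"]] assms
  by auto

text \<open>
  For \<open>i = j\<close> the product in the loop is \<open>e\<close>, but the affine expression has the value \<open>i\<close>; so the
  points of a subloop are affinely closed without exception.
\<close>

lemma subloop_Ln_points_closed:
  assumes "subloop H (Ln n m)" "n > 0" "Pt i \<in> H" "Pt j \<in> H"
  shows "\<exists>s. Pt s \<in> H \<and> [int s = int m * int j - (int m - 1) * int i] (mod int n)"
proof (cases "i = j")
  case True
  then show ?thesis using assms(3) by (intro exI[of _ i]) (simp add: algebra_simps)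
next
  case False
  then obtain s where s: "Ln_mult n m (Pt i) (Pt j) = Pt s"
      "[int s = int m * int j - (int m - 1) * int i] (mod int n)"
    using Ln_mult_Pt_obtain \<open>n > 0\<close> by blast
  interpret loop "Ln n m\<lparr>carrier := H\<rparr>" using assms(1) by (simp add: subloop_def)
  have "Pt s \<in> H" using m_closed[of "Pt i" "Pt j"] assms(3,4) s(1) by (simp add: Ln_def)
  with s(2) show ?thesis by blast
qed

lemma subloop_Ln_eq:
  assumes "subloop H (Ln n m)"
  obtains S where "H = insert E (Pt ` S)" "S \<subseteq> {1..n}"
proof
  interpret loop "Ln n m\<lparr>carrier := H\<rparr>" using assms by (simp add: subloop_def)
  have "E \<in> H" using one_closed by (simp add: Ln_def)
  moreover have "H \<subseteq> insert E (Pt ` {1..n})" using assms by (simp add: subloop_def Ln_def)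
  ultimately show "H = insert E (Pt ` {i. Pt i \<in> H})" "{i. Pt i \<in> H} \<subseteq> {1..n}"
    by auto
qed

lemma card_carrier_neutrosophic_loop:
  assumes "finite (carrier L)"
  shows "card (carrier (neutrosophic_loop L)) = 2 * card (carrier L)"
proof -
  have "card (Plain ` carrier L \<union> Ind ` carrier L)
          = card (Plain ` carrier L) + card (Ind ` carrier L)"
    using assms by (intro card_Un_disjoint) auto
  then show ?thesis
    by (simp add: neutrosophic_loop_def card_image inj_on_def)
qed

theorem theorem4p1p2:
  fixes n m t :: nat and K :: "elt neutrosophic set"
  assumes "n > 3" and "odd n"
    and "0 < m" and "m < n"
    and "gcd m n = 1" and "gcd (m - 1) n = 1"
    and "t > 0"
    and "neutrosophic_subloop K (Ln n m)"
    and "card K = 2 * (t + 1)"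
  shows "t dvd n"
proof -
  obtain H where H: "subloop H (Ln n m)"
      and K: "K = carrier (neutrosophic_loop (Ln n m\<lparr>carrier := H\<rparr>))"
    using assms(8) by (auto simp: neutrosophic_subloop_def)
  obtain S where S: "H = insert E (Pt ` S)" "S \<subseteq> {1..n}"
    using subloop_Ln_eq[OF H] by blast
  have fin: "finite S" using S(2) finite_subset by blast
  then have "card K = 2 * card H"
    unfolding K by (subst card_carrier_neutrosophic_loop) (simp_all add: S(1))
  moreover have "card H = Suc (card S)"
    using fin by (simp add: S(1) card_insert_if image_iff card_image inj_on_def)
  ultimately have t: "card S = t" using assms(9) by simp
  have "card S dvd n"
  proof (rule card_affine_closed_dvd[OF S(2)])
    show "S \<noteq> {}" using t \<open>t > 0\<close> by auto
    show "coprime (int m) (int n)" using assms(5) by (simp add: coprime_iff_gcd_eq_1)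
    have "coprime (int (m - 1)) (int n)" using assms(6) by (simp add: coprime_iff_gcd_eq_1)
    moreover have "1 - int m = - int (m - 1)" using \<open>0 < m\<close> by simp
    ultimately show "coprime (1 - int m) (int n)" by (simp only: coprime_minus_left_iff)
  next
    fix i j assume "i \<in> S" "j \<in> S"
    with subloop_Ln_points_closed[OF H, of i j] \<open>n > 3\<close>
    show "\<exists>s\<in>S. [int s = int m * int j - (int m - 1) * int i] (mod int n)"
      by (auto simp: S(1))
  qed
  then show ?thesis by (simp only: t)
qed

end
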